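(* Let $f=\sum_{m\in[X]}c_m m\in\mathbb{Z}[[X]]$. Then $f=p(I)$ for some monoid ideal $I\subset[X]$ if and only if the following two conditions hold: (1) for all $m\in[X]$, $\sum_{s\mid m}c_s\in\{0,1\}$; (2) if $\sum_{s\mid m}c_s=1$ and $t\mid m$, then $\sum_{s\mid t}c_s=1$.
   Context: $X=\{x_1,x_2,\dots\}$; $[X]$ is the free abelian monoid of monomials in $X$; sums such as $\sum_{s\mid m}$ run over the (finitely many) monomials $s\in[X]$ dividing $m$. A monoid ideal is a subset $I\subset[X]$ with $[X]I\subset I$; monoid ideals correspond bijectively to monomial ideals. $\mathbb{Z}[[X]]$ is the ring of all formal sums $\sum_{m\in[X]}c_m m$, $c_m\in\mathbb{Z}$, with convolution product. The $[X]$-graded Hilbert numerator of a monoid ideal $I$ is $p(I)=\mu\cdot\sum_{m\in[X]\setminus I}m$, where $\mu=\prod_{i\ge1}(1-x_i)\in\mathbb{Z}[[X]]$. *)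

theory Defs
  imports "HOL-Analysis.Analysis"
begin

(* [X] for X = {x_1, x_2, ...}, written additively: a monomial is the multiset of the indices of
   its variables (the variable x_{i+1} has index i), the product of monomials is +, the monomial 1
   is {#}, and s divides m iff s \<subseteq># m. *)
type_synonym monomial = "nat multiset"

lemma finite_monomial_divisors [simp]: "finite {s. s \<subseteq># (m :: monomial)}"
proof -
  have "{s. s \<subseteq># m} \<subseteq> {s. set_mset s \<subseteq> set_mset m \<and> size s \<le> size m}"
    by (auto dest: set_mset_mono size_mset_mono mset_subset_eqD)
  also have "\<dots> \<subseteq> mset ` {xs. set xs \<subseteq> set_mset m \<and> length xs \<le> size m}"
  proof
    fix s assume "s \<in> {s. set_mset s \<subseteq> set_mset m \<and> size s \<le> size m}"
    moreover obtain xs where "s = mset xs" by (metis ex_mset)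
    ultimately show "s \<in> mset ` {xs. set xs \<subseteq> set_mset m \<and> length xs \<le> size m}" by auto
  qed
  finally show ?thesis
    by (rule finite_subset) (intro finite_imageI finite_lists_length_le finite_set_mset)
qed

(* The ring Z[[X]] of all formal sums of the elements of [X]; such a sum is given by its
   coefficient function. *)
typedef zseries = "UNIV :: (monomial \<Rightarrow> int) set"
  morphisms coeff Abs_zseries ..

setup_lifting type_definition_zseries

lemma zseries_eqI: "(\<And>m. coeff f m = coeff g m) \<Longrightarrow> f = g"
  by (simp add: coeff_inject [symmetric] fun_eq_iff)

lemma coeff_Abs [simp]: "coeff (Abs_zseries c) = c"
  by (simp add: Abs_zseries_inverse)

instantiation zseries :: comm_ring_1
begin

lift_definition zero_zseries :: zseries is "\<lambda>m. 0" .
lift_definition one_zseries :: zseries is "\<lambda>m. if m = {#} then 1 else 0" .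
lift_definition plus_zseries :: "zseries \<Rightarrow> zseries \<Rightarrow> zseries" is "\<lambda>f g m. f m + g m" .
lift_definition minus_zseries :: "zseries \<Rightarrow> zseries \<Rightarrow> zseries" is "\<lambda>f g m. f m - g m" .
lift_definition uminus_zseries :: "zseries \<Rightarrow> zseries" is "\<lambda>f m. - f m" .
lift_definition times_zseries :: "zseries \<Rightarrow> zseries \<Rightarrow> zseries"
  is "\<lambda>f g m. \<Sum>s | s \<subseteq># m. f s * g (m - s)" .

instance
proof
  fix f g h :: zseries
  show "f * g = g * f"
  proof (transfer, rule ext)
    fix f g :: "monomial \<Rightarrow> int" and m
    show "(\<Sum>s | s \<subseteq># m. f s * g (m - s)) = (\<Sum>s | s \<subseteq># m. g s * f (m - s))"
      by (rule sum.reindex_bij_witness [of _ "\<lambda>s. m - s" "\<lambda>s. m - s"])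
        (auto simp: mset_subset_eq_exists_conv)
  qed
  show "f * g * h = f * (g * h)"
  proof (transfer, rule ext)
    fix f g h :: "monomial \<Rightarrow> int" and m
    have "(\<Sum>s | s \<subseteq># m. (\<Sum>r | r \<subseteq># s. f r * g (s - r)) * h (m - s))
        = (\<Sum>(s, r)\<in>(SIGMA s:{s. s \<subseteq># m}. {r. r \<subseteq># s}). f r * g (s - r) * h (m - s))"
      by (simp add: sum_distrib_right sum.Sigma)
    also have "\<dots> = (\<Sum>(r, t)\<in>(SIGMA r:{r. r \<subseteq># m}. {t. t \<subseteq># m - r}).
        f r * (g t * h (m - r - t)))"
      by (rule sum.reindex_bij_witness [of _ "\<lambda>(r, t). (r + t, r)" "\<lambda>(s, r). (r, s - r)"])
        (auto simp: mset_subset_eq_exists_conv mult.assoc)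
    also have "\<dots> = (\<Sum>s | s \<subseteq># m. f s * (\<Sum>t | t \<subseteq># m - s. g t * h (m - s - t)))"
      by (simp add: sum_distrib_left sum.Sigma)
    finally show "(\<Sum>s | s \<subseteq># m. (\<Sum>r | r \<subseteq># s. f r * g (s - r)) * h (m - s))
        = (\<Sum>s | s \<subseteq># m. f s * (\<Sum>t | t \<subseteq># m - s. g t * h (m - s - t)))" .
  qed
  show "1 * f = f"
  proof (transfer, rule ext)
    fix f :: "monomial \<Rightarrow> int" and m
    have "(\<Sum>s | s \<subseteq># m. (if s = {#} then 1 else 0) * f (m - s))
        = (\<Sum>s\<in>{{#}}. (if s = {#} then 1 else 0) * f (m - s))"
      by (rule sum.mono_neutral_right) auto
    then show "(\<Sum>s | s \<subseteq># m. (if s = {#} then 1 else 0) * f (m - s)) = f m"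
      by simp
  qed
  show "(f + g) * h = f * h + g * h"
    by transfer (simp add: distrib_right sum.distrib)
  show "(0 :: zseries) \<noteq> 1"
    by transfer (metis zero_neq_one)
qed (transfer; simp add: fun_eq_iff)+

end

(* Convergence in Z[[X]] is coefficientwise: the product topology with Z discrete. *)
instantiation zseries :: t2_space
begin

definition open_zseries :: "zseries set \<Rightarrow> bool"
  where "open_zseries U \<longleftrightarrow> open (coeff ` U)"

lemma coeff_image: "coeff ` U = Abs_zseries -` U"
proof
  show "coeff ` U \<subseteq> Abs_zseries -` U"
    by (auto simp: coeff_inverse)
  show "Abs_zseries -` U \<subseteq> coeff ` U"
  proof
    fix c assume "c \<in> Abs_zseries -` U"
    then show "c \<in> coeff ` U"
      by (intro image_eqI [of _ _ "Abs_zseries c"]) simp_all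
  qed
qed

lemma open_coeff: "open {f. coeff f m \<in> C}"
proof -
  have "open ((\<lambda>c :: monomial \<Rightarrow> int. c m) -` C)"
    by (intro open_vimage open_discrete) simp
  then show ?thesis
    by (simp add: open_zseries_def coeff_image vimage_def)
qed

instance
proof
  show "open (UNIV :: zseries set)"
    by (simp add: open_zseries_def coeff_image)
  show "open (S \<inter> T)" if "open S" "open T" for S T :: "zseries set"
    using that unfolding open_zseries_def coeff_image vimage_Int by (rule open_Int)
  show "open (\<Union>K)" if "\<forall>S\<in>K. open S" for K :: "zseries set set"
    using that unfolding open_zseries_def coeff_image vimage_Union by (intro open_UN) blast
  show "\<exists>U V. open U \<and> open V \<and> f \<in> U \<and> g \<in> V \<and> U \<inter> V = {}" if neq: "f \<noteq> g" for f g :: zseries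
  proof -
    obtain m where "coeff f m \<noteq> coeff g m"
      using neq zseries_eqI by metis
    define U V
      where "U = {h. coeff h m \<in> {coeff f m}}"
        and "V = {h. coeff h m \<in> - {coeff f m}}"
    have "open U" "open V"
      unfolding U_def V_def by (rule open_coeff)+
    moreover have "f \<in> U" "g \<in> V" "U \<inter> V = {}"
      using \<open>coeff f m \<noteq> coeff g m\<close> by (auto simp: U_def V_def)
    ultimately show ?thesis by blast
  qed
qed

end

lemma tendsto_zseries_iff:
  "(F \<longlongrightarrow> f) A \<longleftrightarrow> (\<forall>m. eventually (\<lambda>n. coeff (F n) m = coeff f m) A)"
proof
  assume L: "(F \<longlongrightarrow> f) A"
  show "\<forall>m. eventually (\<lambda>n. coeff (F n) m = coeff f m) A"
  proof
    fix m show "eventually (\<lambda>n. coeff (F n) m = coeff f m) A"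
      using topological_tendstoD [OF L open_coeff [of m "{coeff f m}"]] by simp
  qed
next
  assume R: "\<forall>m. eventually (\<lambda>n. coeff (F n) m = coeff f m) A"
  show "(F \<longlongrightarrow> f) A"
  proof (rule topological_tendstoI)
    fix U assume U: "open U" "f \<in> U"
    then have "openin (product_topology (\<lambda>i. euclidean) UNIV) (coeff ` U)"
      by (simp add: open_zseries_def open_fun_def)
    moreover have "coeff f \<in> coeff ` U" using U by blast
    ultimately obtain W where W: "coeff f \<in> Pi\<^sub>E UNIV W"
        "finite {i. W i \<noteq> topspace (euclidean :: int topology)}" "Pi\<^sub>E UNIV W \<subseteq> coeff ` U"
      by (blast dest: product_topology_open_contains_basis)
    define M where "M = {i. W i \<noteq> UNIV}"
    have "eventually (\<lambda>n. \<forall>m\<in>M. coeff (F n) m = coeff f m) A"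
      using R W(2) by (intro eventually_ball_finite) (auto simp: M_def)
    then show "eventually (\<lambda>n. F n \<in> U) A"
    proof eventually_elim
      case (elim n)
      have "coeff (F n) i \<in> W i" for i
        using elim W(1) by (cases "i \<in> M") (auto simp: M_def PiE_iff)
      then have "coeff (F n) \<in> coeff ` U"
        using W(3) by (auto simp: PiE_iff)
      then show ?case
        by (auto simp: coeff_inject)
    qed
  qed
qed

definition monom :: "monomial \<Rightarrow> zseries"
  where "monom m = Abs_zseries (\<lambda>n. if n = m then 1 else 0)"

definition var :: "nat \<Rightarrow> zseries"
  where "var i = monom {#i#}"

definition formal_sum :: "monomial set \<Rightarrow> zseries"
  where "formal_sum A = Abs_zseries (\<lambda>m. if m \<in> A then 1 else 0)"

definition mu :: zseries
  where "mu = (\<Prod>i. 1 - var i)"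

definition monoid_ideal :: "monomial set \<Rightarrow> bool"
  where "monoid_ideal I \<longleftrightarrow> (\<forall>s. \<forall>m\<in>I. s + m \<in> I)"

definition hilbert_numerator :: "monomial set \<Rightarrow> zseries"
  where "hilbert_numerator I = mu * formal_sum (- I)"

lemma coeff_mult: "coeff (f * g) m = (\<Sum>s | s \<subseteq># m. coeff f s * coeff g (m - s))"
  by transfer simp

lemma coeff_mult_one_minus_var:
  "coeff (f * (1 - var i)) m = coeff f m - (if i \<in># m then coeff f (m - {#i#}) else 0)"
proof -
  have "coeff (f * var i) m
      = (\<Sum>s | s \<subseteq># m. if s = {#i#} then coeff f (m - s) else 0)"
    unfolding mult.commute [of f] coeff_mult by (intro sum.cong) (auto simp: var_def monom_def)
  also have "\<dots> = (if i \<in># m then coeff f (m - {#i#}) else 0)"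
    by (simp add: sum.delta)
  finally have "coeff (f * var i) m = (if i \<in># m then coeff f (m - {#i#}) else 0)" .
  then show ?thesis
    by (simp add: right_diff_distrib minus_zseries.rep_eq)
qed

(* The infinite product converges, so mu is not an unspecified value of the definite description
   behind the product operator. *)
lemma has_prod_mu: "(\<lambda>i. 1 - var i) has_prod mu"
proof -
  define P where "P n = (\<Prod>i\<le>n. 1 - var i)" for n
  define L where "L = Abs_zseries (\<lambda>m. coeff (P (Max (insert 0 (set_mset m)))) m)"
  have P_eq: "coeff (P n) m = coeff (P N) m" if "n \<ge> N" "\<And>i. i \<in># m \<Longrightarrow> i \<le> N" for n N m
    using that(1)
  proof (induction n rule: dec_induct)
    case (step k)
    have "Suc k \<notin># m" using that(2) [of "Suc k"] step.hyps by auto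
    then show ?case using step.IH by (simp add: P_def coeff_mult_one_minus_var)
  qed simp
  have "P \<longlonglongrightarrow> L"
    unfolding tendsto_zseries_iff
  proof
    fix m
    show "eventually (\<lambda>n. coeff (P n) m = coeff L m) sequentially"
      using eventually_ge_at_top [of "Max (insert 0 (set_mset m))"]
      by eventually_elim (auto simp: L_def intro!: P_eq)
  qed
  moreover have "coeff (P n) {#} = 1" for n
    using coeff_mult_one_minus_var [of 1 0 "{#}"]
    by (induction n) (simp_all add: P_def coeff_mult_one_minus_var one_zseries.rep_eq)
  then have "coeff L {#} \<noteq> 0" by (simp add: L_def)
  then have "L \<noteq> 0" by (auto simp: zero_zseries.rep_eq)
  ultimately have raw: "raw_has_prod (\<lambda>i. 1 - var i) 0 L"
    by (simp add: raw_has_prod_def P_def [abs_def])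
  have nz: "1 - var i \<noteq> 0" for i
    using coeff_mult_one_minus_var [of 1 i "{#}"]
    by (auto simp: one_zseries.rep_eq zero_zseries.rep_eq)
  have "(\<lambda>i. 1 - var i) has_prod L"
    using raw by (simp add: has_prod_def)
  moreover have "L' = L" if "(\<lambda>i. 1 - var i) has_prod L'" for L'
    using that raw nz by (auto simp: has_prod_def raw_has_prod_def intro: LIMSEQ_unique)
  ultimately show ?thesis
    unfolding mu_def prodinf_def by (rule theI)
qed

end

theory Submission
  imports Defs
begin

text \<open>
  Multiplication by \<open>Z = formal_sum UNIV\<close>, the zeta function of the divisibility order, turns
  coefficients into divisor sums: the coefficient of \<open>f * Z\<close> at \<open>m\<close> is
  \<open>\<Sum>s | s \<subseteq># m. coeff f s\<close> (lemma \<open>coeff_mult_zeta\<close>). Moreover \<open>mu\<close> is the inverse of \<open>Z\<close>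
  (lemma \<open>mu_mult_zeta\<close>), because \<open>Z\<close> is the product of the geometric series
  \<open>1 + var i + (var i)^2 + \<dots>\<close>. Hence \<open>f = mu * formal_sum (- I)\<close> is the same as
  \<open>f * Z = formal_sum (- I)\<close>, that is, the divisor sums of \<open>f\<close> form the indicator function of the
  complement of \<open>I\<close> (lemma \<open>eq_hilbert_numerator_iff\<close>).

  Now the first condition says that the divisor sums are the indicator function of some set, necessarily
  the set where they equal 1, and the second that this set is closed under divisors, which
  is to say that its complement is a monoid ideal.
\<close>

lemma coeff_formal_sum: "coeff (formal_sum A) m = (if m \<in> A then 1 else 0)"
  by (simp add: formal_sum_def)

lemma coeff_mult_zeta: "coeff (f * formal_sum UNIV) m = (\<Sum>s | s \<subseteq># m. coeff f s)"
  by (simp add: coeff_mult coeff_formal_sum)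

text \<open>
  Each factor \<open>1 - var i\<close> cancels one geometric series in \<open>Z\<close>, so it removes the monomials divisible
  by the \<open>i\<close>th variable.
\<close>

lemma zeta_mult_prod:
  "formal_sum UNIV * (\<Prod>i\<le>n. 1 - var i) = formal_sum {m. \<forall>j\<in>#m. n < j}"
proof (induction n)
  case 0
  show ?case
    by (intro zseries_eqI) (auto simp: coeff_mult_one_minus_var coeff_formal_sum)
next
  case (Suc n)
  have "formal_sum UNIV * (\<Prod>i\<le>Suc n. 1 - var i)
      = formal_sum {m. \<forall>j\<in>#m. n < j} * (1 - var (Suc n))"
    by (simp add: Suc.IH mult.assoc [symmetric])
  also have "\<dots> = formal_sum {m. \<forall>j\<in>#m. Suc n < j}"
  proof (rule zseries_eqI)
    fix m :: monomial
    show "coeff (formal_sum {m. \<forall>j\<in>#m. n < j} * (1 - var (Suc n))) m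
        = coeff (formal_sum {m. \<forall>j\<in>#m. Suc n < j}) m"
    proof (cases "Suc n \<in># m")
      case True
      then obtain k where "m = add_mset (Suc n) k"
        by (metis insert_DiffM)
      then show ?thesis
        by (auto simp: coeff_mult_one_minus_var coeff_formal_sum)
    next
      case False
      then have "(\<forall>j\<in>#m. n < j) \<longleftrightarrow> (\<forall>j\<in>#m. Suc n < j)"
        by (metis Suc_lessD Suc_lessI)
      with False show ?thesis
        by (simp add: coeff_mult_one_minus_var coeff_formal_sum)
    qed
  qed
  finally show ?case .
qed

lemma partial_products_tendsto_mu: "(\<lambda>n. \<Prod>i\<le>n. 1 - var i) \<longlonglongrightarrow> mu"
proof -
  have "coeff (1 - var i) {#} = 1" for i
    using coeff_mult_one_minus_var [of 1 i "{#}"] by (simp add: one_zseries.rep_eq)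
  \<comment> \<open>For a product with a zero factor, \<open>has_prod\<close> constrains only a tail, not the full partial products.\<close>
  then have "1 - var i \<noteq> 0" for i
    by (metis zero_neq_one zero_zseries.rep_eq)
  then show ?thesis
    using has_prod_mu by (auto simp: has_prod_def raw_has_prod_def)
qed

text \<open>
  In the limit the only monomial that survives is 1. Multiplication is continuous since a coefficient
  of a product involves only finitely many coefficients of the factors.
\<close>

lemma mu_mult_zeta: "mu * formal_sum UNIV = 1"
proof -
  define P where "P n = (\<Prod>i\<le>n. 1 - var i)" for n
  have "coeff (mu * formal_sum UNIV) m = coeff 1 m" for m
  proof -
    have "eventually (\<lambda>n. \<forall>s\<in>{s. s \<subseteq># m}. coeff (P n) s = coeff mu s) sequentially"
      using partial_products_tendsto_mu
      by (intro eventually_ball_finite) (auto simp: P_def tendsto_zseries_iff)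
    moreover have "eventually (\<lambda>n. \<forall>j\<in>#m. j \<le> n) sequentially"
      by (intro eventually_ball_finite) (auto intro: eventually_ge_at_top)
    ultimately have "eventually (\<lambda>n. coeff (mu * formal_sum UNIV) m = coeff 1 m) sequentially"
    proof eventually_elim
      case (elim n)
      have "coeff (mu * formal_sum UNIV) m = coeff (P n * formal_sum UNIV) m"
        using elim(1) by (simp add: coeff_mult_zeta)
      also have "\<dots> = coeff (formal_sum {m. \<forall>j\<in>#m. n < j}) m"
        by (simp add: P_def mult.commute zeta_mult_prod)
      also have "\<dots> = coeff 1 m"
      proof (cases "m = {#}")
        case False
        then obtain j where "j \<in># m"
          by (meson multiset_nonemptyE)
        then have "\<not> (\<forall>j\<in>#m. n < j)"
          using elim(2) by (meson not_le)
        with False show ?thesis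
          by (simp add: coeff_formal_sum one_zseries.rep_eq)
      qed (simp add: coeff_formal_sum one_zseries.rep_eq)
      finally show ?case .
    qed
    then show ?thesis
      by simp
  qed
  then show ?thesis
    by (rule zseries_eqI)
qed

text \<open>Moebius inversion on the divisibility order.\<close>

lemma eq_hilbert_numerator_iff:
  "f = hilbert_numerator I \<longleftrightarrow> (\<forall>m. (\<Sum>s | s \<subseteq># m. coeff f s) = (if m \<notin> I then 1 else 0))"
proof -
  have "f = hilbert_numerator I \<longleftrightarrow> f * formal_sum UNIV = formal_sum (- I)"
  proof
    assume "f = hilbert_numerator I"
    then have "f * formal_sum UNIV = mu * formal_sum UNIV * formal_sum (- I)"
      by (simp only: hilbert_numerator_def ac_simps)
    then show "f * formal_sum UNIV = formal_sum (- I)"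
      by (simp add: mu_mult_zeta)
  next
    assume "f * formal_sum UNIV = formal_sum (- I)"
    then have "hilbert_numerator I = mu * formal_sum UNIV * f"
      by (metis hilbert_numerator_def mult.assoc mult.commute)
    then show "f = hilbert_numerator I"
      by (simp add: mu_mult_zeta)
  qed
  also have "\<dots> \<longleftrightarrow> (\<forall>m. coeff (f * formal_sum UNIV) m = coeff (formal_sum (- I)) m)"
    by (metis zseries_eqI)
  finally show ?thesis
    by (simp add: coeff_mult_zeta coeff_formal_sum)
qed

lemma monoid_ideal_iff_divisor_closed:
  "monoid_ideal I \<longleftrightarrow> (\<forall>m t. m \<notin> I \<and> t \<subseteq># m \<longrightarrow> t \<notin> I)"
  unfolding monoid_ideal_def by (metis mset_subset_eq_add_right subset_mset.diff_add)

theorem proposition4p9: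
  fixes f :: zseries
  shows "(\<exists>I. monoid_ideal I \<and> f = hilbert_numerator I) \<longleftrightarrow>
    (\<forall>m. (\<Sum>s | s \<subseteq># m. coeff f s) \<in> {0, 1}) \<and>
    (\<forall>m t. (\<Sum>s | s \<subseteq># m. coeff f s) = 1 \<and> t \<subseteq># m \<longrightarrow> (\<Sum>s | s \<subseteq># t. coeff f s) = 1)"
    (is "_ \<longleftrightarrow> (\<forall>m. ?S m \<in> {0, 1}) \<and> (\<forall>m t. ?S m = 1 \<and> t \<subseteq># m \<longrightarrow> ?S t = 1)")
proof
  assume "\<exists>I. monoid_ideal I \<and> f = hilbert_numerator I"
  then obtain I where "monoid_ideal I" and S: "?S m = (if m \<notin> I then 1 else 0)" for m
    by (auto simp: eq_hilbert_numerator_iff)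
  then show "(\<forall>m. ?S m \<in> {0, 1}) \<and> (\<forall>m t. ?S m = 1 \<and> t \<subseteq># m \<longrightarrow> ?S t = 1)"
    unfolding S by (simp add: monoid_ideal_iff_divisor_closed)
next
  assume R: "(\<forall>m. ?S m \<in> {0, 1}) \<and> (\<forall>m t. ?S m = 1 \<and> t \<subseteq># m \<longrightarrow> ?S t = 1)"
  have "monoid_ideal {m. ?S m \<noteq> 1}"
    using R by (simp add: monoid_ideal_iff_divisor_closed)
  moreover have "f = hilbert_numerator {m. ?S m \<noteq> 1}"
    using R by (auto simp: eq_hilbert_numerator_iff)
  ultimately show "\<exists>I. monoid_ideal I \<and> f = hilbert_numerator I"
    by blast
qed

end
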